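(* Let $q$ be a prime power, and let $\mathcal{C}$ be an almost optimal locally repairable code with disjoint local repair groups and parameters $(n=3L,\,k=2L-4,\,d=7,\,r=2)_q$. Then $$n\leq 3+q(q+1).$$
   Context: Here $n,k,d,r$ are positive integers. A $q$-ary $[n,k,d]$ linear code $\mathcal{C}\subseteq\mathbb{F}_q^n$ (length $n$, dimension $k$, minimum Hamming distance $d$) is a locally repairable code (LRC) with locality $r$, with parameters denoted $(n,k,d,r)_q$, if for every $i\in[n]=\{1,\dots,n\}$ there are a set $R_i\subseteq[n]\setminus\{i\}$ with $|R_i|\le r$ and fixed nonzero elements $k_j\in\mathbb{F}_q\setminus\{0\}$ ($j\in R_i$) such that $c_i=\sum_{j\in R_i}k_jc_j$ for every codeword $(c_1,\dots,c_n)\in\mathcal{C}$. Such a set $R_i\cup\{i\}$ is called a local repair group. $\mathcal{C}$ has disjoint local repair groups if some local repair groups form a partition of $[n]$ and each of them has cardinality $r+1$. An LRC with parameters $(n,k,d,r)_q$ is almost optimal if $d=n-k-\lceil k/r\rceil+1$ (one less than the Singleton-like bound $d\le n-k-\lceil k/r\rceil+2$); the parameters in the claim satisfy this equality automatically. *)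

theory Defs
  imports "HOL-Analysis.Analysis" "HOL-Number_Theory.Prime_Powers" "HOL-Library.Disjoint_Sets"
begin

text \<open>
  The field \<open>\<F>\<^sub>q\<close> is a finite field type \<open>'a\<close>, and the coordinate set \<open>[n]\<close> is a finite type \<open>'n\<close>
  with \<open>n\<close> elements, so that words of length \<open>n\<close> are the vectors \<open>'a ^ 'n\<close>.
\<close>

definition hamming_dist :: "'a ^ 'n::finite \<Rightarrow> 'a ^ 'n \<Rightarrow> nat" where
  "hamming_dist x y = card {i. x $ i \<noteq> y $ i}"

text \<open>
  The infimum is attained when \<open>C\<close> has at least two elements; otherwise it is \<open>0\<close>, which is
  excluded below by requiring all code parameters to be positive.
\<close>

definition min_distance :: "('a ^ 'n::finite) set \<Rightarrow> nat" where
  "min_distance C = Inf {hamming_dist x y | x y. x \<in> C \<and> y \<in> C \<and> x \<noteq> y}"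

definition linear_code ::
  "('a::{field,finite} ^ 'n::finite) set \<Rightarrow> nat \<Rightarrow> nat \<Rightarrow> nat \<Rightarrow> bool" where
  "linear_code C n k d \<longleftrightarrow>
     CARD('n) = n \<and> vec.subspace C \<and> vec.dim C = k \<and> min_distance C = d"

definition repair_set ::
  "('a::{field,finite} ^ 'n::finite) set \<Rightarrow> nat \<Rightarrow> 'n \<Rightarrow> 'n set \<Rightarrow> bool" where
  "repair_set C r i R \<longleftrightarrow>
     R \<subseteq> UNIV - {i} \<and> card R \<le> r \<and>
     (\<exists>a :: 'n \<Rightarrow> 'a. (\<forall>j\<in>R. a j \<noteq> 0) \<and> (\<forall>c\<in>C. c $ i = (\<Sum>j\<in>R. a j * c $ j)))"

definition local_repair_group ::
  "('a::{field,finite} ^ 'n::finite) set \<Rightarrow> nat \<Rightarrow> 'n set \<Rightarrow> bool" where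
  "local_repair_group C r G \<longleftrightarrow> (\<exists>i R. repair_set C r i R \<and> G = R \<union> {i})"

definition locally_repairable_code ::
  "('a::{field,finite} ^ 'n::finite) set \<Rightarrow> nat \<Rightarrow> nat \<Rightarrow> nat \<Rightarrow> nat \<Rightarrow> bool" where
  "locally_repairable_code C n k d r \<longleftrightarrow>
     0 < n \<and> 0 < k \<and> 0 < d \<and> 0 < r \<and>
     linear_code C n k d \<and> (\<forall>i. \<exists>R. repair_set C r i R)"

definition disjoint_local_repair_groups ::
  "('a::{field,finite} ^ 'n::finite) set \<Rightarrow> nat \<Rightarrow> bool" where
  "disjoint_local_repair_groups C r \<longleftrightarrow>
     (\<exists>P. partition_on UNIV P \<and> (\<forall>G\<in>P. local_repair_group C r G \<and> card G = r + 1))"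

definition almost_optimal_lrc ::
  "('a::{field,finite} ^ 'n::finite) set \<Rightarrow> nat \<Rightarrow> nat \<Rightarrow> nat \<Rightarrow> nat \<Rightarrow> bool" where
  "almost_optimal_lrc C n k d r \<longleftrightarrow>
     locally_repairable_code C n k d r \<and>
     int d = int n - int k - \<lceil>real k / real r\<rceil> + 1"

end

theory Submission
  imports Defs
begin

text \<open>
  Let \<open>D \<supseteq> C\<close> be the code defined by the local parity checks alone; it has dimension \<open>2L\<close>, so
  \<open>D / C\<close> is 4-dimensional. Every coordinate \<open>s\<close> yields a word \<open>v s \<in> D\<close> of weight 2, supported on
  the group of \<open>s\<close> without \<open>s\<close> itself, hence a point of \<open>PG(3,q)\<close>. Since three words of weight 2
  have joint weight at most \<open>6 < d\<close>, a line through two of these points contains no third one,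
  unless it is the line spanned by a group. The \<open>q\<^sup>2 + q + 1\<close> lines through a fixed
  point are therefore at least as many as the coordinates outside its group, plus one.
\<close>

lemma min_distance_le:
  assumes "x \<in> C" "y \<in> C" "x \<noteq> y"
  shows "min_distance C \<le> hamming_dist x y"
  unfolding min_distance_def by (rule cInf_lower) (use assms in auto)

text \<open>Coordinates with respect to a basis \<open>B\<close> are unique, so the vectors of
  \<open>S\<close> correspond to the extensional functions from \<open>B\<close> to the
  field.\<close>

lemma card_subspace:
  fixes S :: "('a::{field,finite} ^ 'n::finite) set"
  assumes "vec.subspace S"
  shows "card S = CARD('a) ^ vec.dim S"
proof -
  obtain B where B: "B \<subseteq> S" "vec.independent B" "S \<subseteq> vec.span B" "card B = vec.dim S"
    using vec.basis_exists by blast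
  have fin: "finite B" by simp
  have span: "vec.span B = S"
    using B assms by (simp add: subset_antisym vec.span_minimal)
  let ?f = "\<lambda>c. \<Sum>b\<in>B. c b *s b"
  have "inj_on ?f (B \<rightarrow>\<^sub>E UNIV)"
  proof (rule inj_onI)
    fix c c' assume c: "c \<in> B \<rightarrow>\<^sub>E UNIV" "c' \<in> B \<rightarrow>\<^sub>E UNIV" and eq: "?f c = ?f c'"
    have "(\<Sum>b\<in>B. (c b - c' b) *s b) = 0"
      using eq by (simp add: vec.scale_left_diff_distrib sum_subtractf)
    then have "c b - c' b = 0" if "b \<in> B" for b
      using vec.independentD[OF B(2) fin subset_refl _ that, of "\<lambda>b. c b - c' b"] by simp
    then show "c = c'" using c by (auto intro: PiE_ext)
  qed
  then have "card (?f ` (B \<rightarrow>\<^sub>E UNIV)) = card (B \<rightarrow>\<^sub>E (UNIV :: 'a set))"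
    by (rule card_image)
  moreover have "?f ` (B \<rightarrow>\<^sub>E UNIV) = S"
  proof -
    have "?f c \<in> ?f ` (B \<rightarrow>\<^sub>E UNIV)" for c
      by (rule image_eqI[of _ _ "restrict c B"]) auto
    then show ?thesis using span vec.span_finite[OF fin] by auto
  qed
  ultimately have "card S = card (B \<rightarrow>\<^sub>E (UNIV :: 'a set))"
    by simp
  then show ?thesis using B(4) by (simp add: card_PiE)
qed

text \<open>
  Counts lines through the point \<open>u\<close> of the projective space of \<open>D / C\<close>: those through the
  points \<open>v s\<close> are distinct.
\<close>

lemma card_lines_through_point:
  fixes C D :: "('a::{field,finite} ^ 'n::finite) set" and v :: "'s \<Rightarrow> 'a ^ 'n"
  assumes C: "vec.subspace C" and D: "vec.subspace D" and CD: "C \<subseteq> D"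
    and u: "u \<in> D" and v: "\<And>s. s \<in> I \<Longrightarrow> v s \<in> D"
    and point: "\<And>s a b. s \<in> I \<Longrightarrow> a *s u + b *s v s \<in> C \<Longrightarrow> a = 0 \<and> b = 0"
    and line: "\<And>s s' a b b'. s \<in> I \<Longrightarrow> s' \<in> I \<Longrightarrow> s \<noteq> s' \<Longrightarrow>
                 a *s u + b *s v s + b' *s v s' \<in> C \<Longrightarrow> b = 0"
  shows "card I * (CARD('a) * (CARD('a) - 1)) * card C < card D"
proof -
  \<comment> \<open>Modulo \<open>C\<close>, the combinations with \<open>b \<noteq> 0\<close> are
    the vectors on the line through \<open>u\<close> and \<open>v s\<close> that do not represent
    \<open>u\<close> itself; \<open>c\<close> then runs through the coset.\<close>
  let ?X = "I \<times> (UNIV :: 'a set) \<times> (UNIV - {0 :: 'a}) \<times> C"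
  let ?f = "\<lambda>(s, a, b, c). a *s u + b *s v s + c"
  have inj: "s = s' \<and> a = a' \<and> b = b' \<and> c = c'"
    if s: "s \<in> I" "s' \<in> I" and b: "b \<noteq> 0" and c: "c \<in> C" "c' \<in> C"
      and eq: "a *s u + b *s v s + c = a' *s u + b' *s v s' + c'"
    for s s' a a' b b' c c'
  proof -
    have cc: "c' - c \<in> C" using C c by (simp add: vec.subspace_diff)
    have "(a - a') *s u + b *s v s + (- b') *s v s' = c' - c"
      using eq by (simp add: algebra_simps)
    then have "s = s'" using line[OF s, of "a - a'" b "- b'"] cc b by metis
    moreover from this have "(a - a') *s u + (b - b') *s v s = c' - c"
      using eq by (simp add: algebra_simps)
    then have "a - a' = 0 \<and> b - b' = 0" using point[OF s(1)] cc by metis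
    ultimately show ?thesis using eq by simp
  qed
  have "inj_on ?f ?X"
  proof (rule inj_onI)
    fix x y assume xy: "x \<in> ?X" "y \<in> ?X" "?f x = ?f y"
    obtain s a b c s' a' b' c' where "x = (s, a, b, c)" "y = (s', a', b', c')"
      by (metis prod.exhaust)
    then show "x = y" using xy inj[of s s' b c c' a a' b'] by simp
  qed
  then have "card (?f ` ?X) = card ?X" by (rule card_image)
  also have "\<dots> = card I * (CARD('a) * (CARD('a) - 1)) * card C"
    by (simp add: card_cartesian_product card_Diff_singleton algebra_simps)
  finally have card: "card (?f ` ?X) = card I * (CARD('a) * (CARD('a) - 1)) * card C" .
  have "?f ` ?X \<subseteq> D"
    using u v CD D by (auto intro!: vec.subspace_add vec.subspace_scale)
  \<comment> \<open>The missed zero vector makes the inclusion in \<open>D\<close>, and so the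
    bound, strict.\<close>
  moreover have "0 \<notin> ?f ` ?X"
  proof
    assume "0 \<in> ?f ` ?X"
    then obtain x where x: "x \<in> ?X" "0 = ?f x" by blast
    obtain s a b c where "x = (s, a, b, c)" by (metis prod.exhaust)
    then have s: "s \<in> I" "b \<noteq> 0" "c \<in> C" and eq: "0 = a *s u + b *s v s + c"
      using x by auto
    have "a *s u + b *s v s = - c" using eq by (metis add_eq_0_iff2)
    then show False using point[OF s(1), of a b] s vec.subspace_neg[OF C] by metis
  qed
  moreover have "0 \<in> D" using D by (rule vec.subspace_0)
  ultimately have "?f ` ?X \<subset> D" by blast
  then show ?thesis using card psubset_card_mono[of D "?f ` ?X"] by simp
qed

lemma partition_on_cell:
  assumes "partition_on UNIV P"
  obtains g where "\<And>j. g j \<in> P" "\<And>j. j \<in> g j" "\<And>G j. G \<in> P \<Longrightarrow> j \<in> G \<Longrightarrow> g j = G"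
proof -
  have "\<forall>j. \<exists>G. G \<in> P \<and> j \<in> G"
    using partition_onD1[OF assms] by blast
  then obtain g where g: "\<And>j. g j \<in> P" "\<And>j. j \<in> g j" by metis
  moreover have "g j = G" if "G \<in> P" "j \<in> G" for j G
    using disjointD[OF partition_onD2[OF assms] g(1)[of j] that(1)] g(2)[of j] that(2) by blast
  ultimately show ?thesis by (rule that)
qed

lemma local_parity_check:
  assumes "local_repair_group C r G"
  shows "\<exists>h. (\<forall>j\<in>G. h j \<noteq> 0) \<and> (\<forall>c\<in>C. (\<Sum>j\<in>G. h j * c $ j) = 0)"
proof -
  obtain i R a where R: "i \<notin> R" "G = insert i R" "\<forall>j\<in>R. a j \<noteq> 0"
      "\<forall>c\<in>C. c $ i = (\<Sum>j\<in>R. a j * c $ j)"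
    using assms unfolding local_repair_group_def repair_set_def by auto
  \<comment> \<open>Moving \<open>c $ i\<close> to the other side gives the repaired coordinate the
    nonzero coefficient -1.\<close>
  let ?h = "a(i := - 1)"
  have "(\<Sum>j\<in>G. ?h j * c $ j) = 0" if "c \<in> C" for c
  proof -
    have "(\<Sum>j\<in>R. ?h j * c $ j) = (\<Sum>j\<in>R. a j * c $ j)"
      by (rule sum.cong) (use R(1) in auto)
    then show ?thesis using R that by simp
  qed
  moreover have "\<forall>j\<in>G. ?h j \<noteq> 0" using R by simp
  ultimately show ?thesis by blast
qed

text \<open>Each coordinate lies in exactly one group, so the coefficients of the separate checks
  glue to a single function \<open>h\<close>.\<close>

lemma partition_parity_checks:
  fixes C :: "('a::{field,finite} ^ 'n::finite) set"
  assumes P: "partition_on UNIV P" and grp: "\<forall>G\<in>P. local_repair_group C r G"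
  obtains h :: "'n \<Rightarrow> 'a" where "\<And>j. h j \<noteq> 0"
    and "\<And>G c. G \<in> P \<Longrightarrow> c \<in> C \<Longrightarrow> (\<Sum>j\<in>G. h j * c $ j) = 0"
proof -
  have "\<forall>G\<in>P. \<exists>h. (\<forall>j\<in>G. h j \<noteq> 0) \<and> (\<forall>c\<in>C. (\<Sum>j\<in>G. h j * c $ j) = 0)"
    using grp local_parity_check by blast
  then obtain H where H: "\<And>G j. G \<in> P \<Longrightarrow> j \<in> G \<Longrightarrow> H G j \<noteq> 0"
      "\<And>G c. G \<in> P \<Longrightarrow> c \<in> C \<Longrightarrow> (\<Sum>j\<in>G. H G j * c $ j) = 0"
    by metis
  obtain g where g: "\<And>j. g j \<in> P" "\<And>j. j \<in> g j"
    and g_eq: "\<And>G j. G \<in> P \<Longrightarrow> j \<in> G \<Longrightarrow> g j = G"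
    using partition_on_cell[OF P] by blast
  show ?thesis
  proof (rule that[of "\<lambda>j. H (g j) j"])
    show "H (g j) j \<noteq> 0" for j using g H(1) by blast
    show "(\<Sum>j\<in>G. H (g j) j * c $ j) = 0" if "G \<in> P" "c \<in> C" for G c
      using H(2)[OF that] g_eq[OF that(1)] by simp
  qed
qed

definition checked_words :: "'n set set \<Rightarrow> ('n \<Rightarrow> 'a) \<Rightarrow> ('a::{field,finite} ^ 'n::finite) set" where
  "checked_words P h = {x. \<forall>G\<in>P. (\<Sum>j\<in>G. h j * x $ j) = 0}"

lemma subspace_checked_words:
  fixes h :: "'n::finite \<Rightarrow> 'a::{field,finite}"
  shows "vec.subspace (checked_words P h)"
proof -
  have "(\<Sum>j\<in>G. h j * (c * x $ j)) = c * (\<Sum>j\<in>G. h j * x $ j)"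
    for G :: "'n set" and c :: 'a and x :: "'a ^ 'n"
    by (simp add: sum_distrib_left algebra_simps)
  then show ?thesis
    unfolding checked_words_def
    by (intro vec.subspaceI) (auto simp: algebra_simps sum.distrib)
qed

text \<open>In each cell pick a representative. Its coefficient is nonzero, so the check recovers
  its entry from the others, and a word is determined by its entries off the
  representatives.\<close>

lemma card_checked_words_le:
  fixes h :: "'n::finite \<Rightarrow> 'a::{field,finite}"
  assumes P: "partition_on UNIV P" and h: "\<And>j. h j \<noteq> 0"
  shows "card (checked_words P h) \<le> CARD('a) ^ (CARD('n) - card P)"
proof -
  have "\<forall>G\<in>P. \<exists>t. t \<in> G" using partition_onD3[OF P] by (metis ex_in_conv)
  then obtain t where t: "\<And>G. G \<in> P \<Longrightarrow> t G \<in> G" by metis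
  have disj: "G = G'" if "G \<in> P" "G' \<in> P" "j \<in> G" "j \<in> G'" for G G' j
    using disjointD[OF partition_onD2[OF P] that(1,2)] that(3,4) by blast
  have inj_t: "inj_on t P" using t disj by (metis inj_onI)
  let ?T = "- t ` P"
  have cardT: "card ?T = CARD('n) - card P"
    by (simp add: Compl_eq_Diff_UNIV card_Diff_subset inj_t card_image)
  let ?f = "\<lambda>x :: 'a ^ 'n. restrict (($) x) ?T"
  have "inj_on ?f (checked_words P h)"
  proof (rule inj_onI)
    fix x y assume xy: "x \<in> checked_words P h" "y \<in> checked_words P h" and eq: "?f x = ?f y"
    have off: "x $ j = y $ j" if "j \<notin> t ` P" for j
      using fun_cong[OF eq, of j] that by simp
    have "x $ t G = y $ t G" if G: "G \<in> P" for G
    proof -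
      have split: "(\<Sum>j\<in>G. h j * z $ j) = h (t G) * z $ t G + (\<Sum>j\<in>G - {t G}. h j * z $ j)"
        for z by (rule sum.remove) (use t[OF G] in auto)
      have "(\<Sum>j\<in>G - {t G}. h j * x $ j) = (\<Sum>j\<in>G - {t G}. h j * y $ j)"
      proof (rule sum.cong)
        fix j assume "j \<in> G - {t G}"
        then have "j \<notin> t ` P" using t disj G by blast
        then show "h j * x $ j = h j * y $ j" using off by simp
      qed simp
      moreover have "(\<Sum>j\<in>G. h j * x $ j) = 0" "(\<Sum>j\<in>G. h j * y $ j) = 0"
        using xy G by (auto simp: checked_words_def)
      ultimately have "h (t G) * x $ t G = h (t G) * y $ t G"
        by (metis split add_right_cancel)
      then show ?thesis using h by simp
    qed
    then show "x = y" using off by (metis imageE vec_eq_iff)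
  qed
  then have "card (checked_words P h) \<le> card (?T \<rightarrow>\<^sub>E (UNIV :: 'a set))"
    by (rule card_inj_on_le) (auto simp: finite_PiE)
  then show ?thesis by (simp add: card_PiE cardT)
qed

text \<open>The entries \<open>1 / h i\<close> and \<open>- (1 / h j)\<close> at the two remaining
  coordinates cancel in the check of \<open>G\<close>, and every other cell misses both
  coordinates.\<close>

lemma weight_two_checked_word:
  fixes h :: "'n::finite \<Rightarrow> 'a::{field,finite}"
  assumes P: "partition_on UNIV P" and h: "\<And>j. h j \<noteq> 0"
    and G: "G \<in> P" "card G = 3" "s \<in> G"
  shows "\<exists>x \<in> checked_words P h. {j. x $ j \<noteq> 0} = G - {s}"
proof -
  have "card (G - {s}) = 2" using G by simp
  then obtain i j where ij: "G - {s} = {i, j}" "i \<noteq> j" by (meson card_2_iff)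
  then have Geq: "G = {s, i, j}" "s \<noteq> i" "s \<noteq> j" using G(3) by auto
  define x :: "'a ^ 'n" where
    "x = (\<chi> l. if l = i then 1 / h i else if l = j then - (1 / h j) else 0)"
  have "(\<Sum>l\<in>G'. h l * x $ l) = 0" if "G' \<in> P" for G'
  proof (cases "G' = G")
    case True
    then show ?thesis using Geq ij(2) h by (simp add: x_def)
  next
    case False
    then have "i \<notin> G'" "j \<notin> G'"
      using partition_onD2[OF P] that G(1) Geq(1) by (auto dest: disjointD)
    then show ?thesis by (intro sum.neutral) (auto simp: x_def)
  qed
  then have "x \<in> checked_words P h" by (simp add: checked_words_def)
  moreover have "{l. x $ l \<noteq> 0} = G - {s}" using ij h by (auto simp: x_def)
  ultimately show ?thesis by blast
qed

theorem lemma4: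
  fixes C :: "('a::{field,finite} ^ 'n::finite) set"
    and q n k L :: nat
  assumes "primepow q" and "CARD('a) = q"
    and "n = 3 * L" and "int k = 2 * int L - 4"
    and "almost_optimal_lrc C n k 7 2"
    and "disjoint_local_repair_groups C 2"
  shows "n \<le> 3 + q * (q + 1)"
proof -
  have n: "CARD('n) = n" "0 < n" and C: "vec.subspace C" and dim: "vec.dim C = k"
    and dist: "min_distance C = 7"
    using assms(5)
    by (auto simp: almost_optimal_lrc_def locally_repairable_code_def linear_code_def)
  have q: "q \<ge> 2" using assms(1) primepow_gt_Suc_0[of q] by simp
  obtain P where P: "partition_on UNIV P" and grp: "\<forall>G\<in>P. local_repair_group C 2 G"
    and card3: "\<And>G. G \<in> P \<Longrightarrow> card G = 3"
    using assms(6) by (auto simp: disjoint_local_repair_groups_def)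
  have "CARD('n) = (\<Sum>G\<in>P. card G)"
    using product_partition[OF P] by simp
  then have cardP: "card P = L" using card3 n assms(3) by simp
  obtain h :: "'n \<Rightarrow> 'a" where h: "\<And>j. h j \<noteq> 0"
    and hC: "\<And>G c. G \<in> P \<Longrightarrow> c \<in> C \<Longrightarrow> (\<Sum>j\<in>G. h j * c $ j) = 0"
    using partition_parity_checks[OF P grp] by blast
  define D where "D = checked_words P h"
  have D: "vec.subspace D" by (simp add: D_def subspace_checked_words)
  have CD: "C \<subseteq> D" using hC by (auto simp: D_def checked_words_def)
  \<comment> \<open>Here \<open>3 * L - L = 2 * L = k + 4\<close>: \<open>C\<close> has codimension
    at most 4 in \<open>D\<close>.\<close>
  have "n - card P = k + 4" using assms(3,4) cardP by linarith
  then have cardD: "card D \<le> q ^ (k + 4)"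
    using card_checked_words_le[OF P h] n assms(2) by (simp add: D_def)
  have cardC: "card C = q ^ k" using card_subspace[OF C] dim assms(2) by simp
  obtain g where g: "\<And>j. g j \<in> P" "\<And>j. j \<in> g j"
    and cell: "\<And>G j. G \<in> P \<Longrightarrow> j \<in> G \<Longrightarrow> g j = G"
    using partition_on_cell[OF P] by blast
  have g_eq: "g i = g j" if "i \<in> g j" for i j
    using cell[OF g(1) that] .
  have "\<forall>s. \<exists>x. x \<in> D \<and> {j. x $ j \<noteq> 0} = g s - {s}"
    using weight_two_checked_word[OF P h] g card3 unfolding D_def by meson
  then obtain v where v: "\<And>s. v s \<in> D" "\<And>s. {j. v s $ j \<noteq> 0} = g s - {s}"
    by metis
  have v0: "v s $ j \<noteq> 0 \<longleftrightarrow> j \<in> g s \<and> j \<noteq> s" for s j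
    using v(2)[of s] by blast
  have g2: "\<exists>j \<in> g s. j \<noteq> s" for s
  proof -
    have "card (g s - {s}) = 2" using card3 g by simp
    then show ?thesis by (metis Diff_iff all_not_in_conv card.empty insertI1 zero_neq_numeral)
  qed
  \<comment> \<open>A dependence modulo \<open>C\<close> is thus a dependence of the words
    themselves and can be tested coordinate by coordinate.\<close>
  have small: "a *s v s1 + b *s v s2 + c *s v s3 = 0"
    if "a *s v s1 + b *s v s2 + c *s v s3 \<in> C" (is "?x \<in> C") for a b c s1 s2 s3
  proof (rule ccontr)
    assume "?x \<noteq> 0"
    then have "7 \<le> hamming_dist ?x 0"
      using min_distance_le[OF that vec.subspace_0[OF C]] dist by simp
    also have "\<dots> \<le> card ((g s1 - {s1}) \<union> (g s2 - {s2}) \<union> (g s3 - {s3}))"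
      unfolding hamming_dist_def v(2)[symmetric] by (intro card_mono) auto
    also have "\<dots> \<le> card (g s1 - {s1}) + card (g s2 - {s2}) + card (g s3 - {s3})"
      by (meson add_mono card_Un_le le_refl le_trans)
    also have "\<dots> = 6" using card3 g by simp
    finally show False by simp
  qed
  obtain s0 :: 'n where True by simp
  obtain s1 where s1: "s1 \<in> g s0" "s1 \<noteq> s0" using g2 by blast
  \<comment> \<open>The three points of the group of \<open>s0\<close> are collinear, so only one of them besides
    \<open>v s0\<close> may be kept.\<close>
  define I where "I = UNIV - {s0, s1}"
  have cardI: "card I = n - 2" using s1 n by (simp add: I_def card_Diff_subset)
  \<comment> \<open>The group of \<open>s0\<close> has three coordinates, two of which were
    discarded.\<close>
  have in_I: "s = s'" if "s \<in> I" "s' \<in> I" "s \<in> g s0" "s' \<in> g s0" for s s'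
  proof (rule ccontr)
    assume "s \<noteq> s'"
    then have "card {s0, s1, s, s'} = 4" using that s1 by (auto simp: I_def)
    moreover have "{s0, s1, s, s'} \<subseteq> g s0" using that s1 g by auto
    ultimately have "4 \<le> card (g s0)" by (metis card_mono finite)
    then show False using card3 g by simp
  qed
  have point: "a = 0 \<and> b = 0" if s: "s \<in> I" and "a *s v s0 + b *s v s \<in> C" for s a b
  proof -
    have "a *s v s0 + b *s v s = 0" using small[of a s0 b s 0 s] that by simp
    then have eq: "a * v s0 $ j + b * v s $ j = 0" for j by (simp add: vec_eq_iff)
    \<comment> \<open>If \<open>s\<close> shares the group of \<open>s0\<close>, then
      \<open>j = s0\<close> works; otherwise any \<open>j\<close> in the support of
      \<open>v s\<close> does.\<close>
    have "\<exists>j. v s0 $ j = 0 \<and> v s $ j \<noteq> 0"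
    proof (cases "s0 \<in> g s")
      case True
      then show ?thesis using v0 s by (auto simp: I_def)
    next
      case False
      then show ?thesis using v0 g2 g g_eq by metis
    qed
    then have "b = 0" using eq by (metis add_0 mult_eq_0_iff mult_zero_right)
    moreover have "\<exists>j. v s0 $ j \<noteq> 0" using v0 g2 by metis
    ultimately show ?thesis using eq by auto
  qed
  have line: "b = 0" if s: "s \<in> I" "s' \<in> I" "s \<noteq> s'"
    and mem: "a *s v s0 + b *s v s + b' *s v s' \<in> C" for s s' a b b'
  proof -
    have eq: "a * v s0 $ j + b * v s $ j + b' * v s' $ j = 0" for j
      using small[OF mem] by (simp add: vec_eq_iff)
    have b_if: "b = 0" if "v s0 $ j = 0" "v s' $ j = 0" "v s $ j \<noteq> 0" for j
      using eq[of j] that by simp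
    \<comment> \<open>If \<open>s\<close> lies outside the group of \<open>s0\<close>, some
      coordinate sees only \<open>v s\<close>: it is \<open>s'\<close> when \<open>s'\<close> shares
      the group of \<open>s\<close>, and any point of the support of \<open>v s\<close> otherwise.
      If \<open>s\<close> lies in the group of \<open>s0\<close>, then \<open>s'\<close> does not,
      so \<open>b' = 0\<close> and the claim reduces to \<open>point\<close>.\<close>
    show "b = 0"
    proof (cases "s \<in> g s0")
      case False
      then have off: "v s0 $ j = 0" if "j \<in> g s" for j using v0 g g_eq that by metis
      show ?thesis
      proof (cases "s' \<in> g s")
        case True
        then show ?thesis using b_if[of s'] off v0 s(3) by blast
      next
        case False
        obtain j where "j \<in> g s" "j \<noteq> s" using g2 by blast
        then show ?thesis using b_if[of j] off False v0 g g_eq by metis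
      qed
    next
      case True
      then have s': "s' \<notin> g s0" using in_I s by blast
      then have "v s0 $ j = 0 \<and> v s $ j = 0" if "j \<in> g s'" for j
        using v0 g g_eq that True by metis
      moreover obtain j where "j \<in> g s'" "j \<noteq> s'" using g2 by blast
      ultimately have "b' = 0" using eq[of j] v0 by auto
      then show ?thesis using point[OF s(1)] mem by simp
    qed
  qed
  have "(n - 2) * (q * (q - 1)) * q ^ k < card D"
    using card_lines_through_point[of C D "v s0" I v, OF C D CD v(1) v(1) point line]
    unfolding cardI cardC assms(2) .
  also have "\<dots> \<le> q ^ (k + 4)" by (rule cardD)
  also have "\<dots> = q ^ 3 * q * q ^ k" by (simp add: power_add eval_nat_numeral)
  finally have "((n - 2) * (q - 1)) * q < q ^ 3 * q"
    using q by (simp add: mult.assoc mult.left_commute)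
  then have bound: "(n - 2) * (q - 1) < q ^ 3" by simp
  \<comment> \<open>Since \<open>q^3 - 1 = (q - 1) * (q * (q + 1) + 1)\<close>, the strict bound
    gives \<open>n - 2 \<le> q * (q + 1) + 1\<close>. Writing \<open>p\<close> for
    \<open>q - 1\<close> avoids truncated subtraction, and raising the right factor by one gives a
    strict inequality from which \<open>p\<close> cancels.\<close>
  obtain p where p: "q = Suc p" "p \<ge> 1" using q by (cases q) auto
  have "(n - 2) * p < (q * (q + 1) + 2) * p"
  proof -
    have "(n - 2) * p \<le> (q * (q + 1) + 1) * p"
      using bound p by (simp add: eval_nat_numeral algebra_simps)
    then show ?thesis using p by simp
  qed
  then have "n - 2 < q * (q + 1) + 2" by (simp only: mult_less_cancel2)
  then show ?thesis by simp
qed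

end
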